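(* Let $\mathcal{H}_{1}$ and $\mathcal{H}_{2}$ be two complex Hilbert spaces. For $i=1,2$, let $P'_i$ be a Rota-Baxter operator of weight $-1$ on $B(\mathcal{H}_{i})$, let $\mathcal{A}_{i}$ be a $C^{\ast}$-subalgebra of $B(\mathcal{H}_{i})$, and let $P_{i}$ be a Rota-Baxter operator of weight $-1$ on $\mathcal{A}_{i}$. Set $\mathcal{H}=\mathcal{H}_{1}\oplus\mathcal{H}_{2}$ and let $p$ be the (orthogonal) projection from $\mathcal{H}$ onto $\mathcal{H}_{1}$. Let $P'$ be the Rota-Baxter operator of weight $-1$ on $B(\mathcal{H})$ corresponding to $P'_{1}\oplus P'_{2}$ on $B(\mathcal{H}_{1})\oplus B(\mathcal{H}_{2})$, namely $$P'\left(\begin{bmatrix} a_{11}&a_{12}\\ a_{21}&a_{22}\end{bmatrix}\right)=\begin{bmatrix} P'_1(a_{11})&a_{12}\\ 0&P'_2(a_{22})\end{bmatrix}.$$ Then the following two statements are equivalent: (a) there are Rota-Baxter $\ast$-representations $\{\pi_{i},\mathcal{H}_i,\mathrm{id}_{\mathcal{H}_i}\}$ from $(\mathcal{A}_{i},P_{i})$ into $(B(\mathcal{H}_{i}),P'_{i})$ for $i=1,2$; (b) there is a Rota-Baxter $\ast$-representation $\{\pi,\mathcal{H},p\}$ from $(\mathcal{A}_{1}\oplus\mathcal{A}_{2},P_{1}\oplus P_{2})$ into $(B(\mathcal{H}),P')$ such that $\pi(\mathcal{A}_{i})\subseteq B(\mathcal{H}_{i})$ for $i=1,2$.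
   Context: $B(\mathcal{H})$ is the $C^{\ast}$-algebra of bounded linear operators on $\mathcal{H}$; elements of $B(\mathcal{H}_1\oplus\mathcal{H}_2)$ are written as $2\times2$ block matrices with $a_{ij}:\mathcal{H}_j\to\mathcal{H}_i$. $B(\mathcal{H}_1)\oplus B(\mathcal{H}_2)$ is regarded as the $C^{\ast}$-subalgebra of block diagonal operators in $B(\mathcal{H})$, and so $B(\mathcal{H}_1)$, $B(\mathcal{H}_2)$ are regarded as subalgebras (corners) of $B(\mathcal{H})$. Each $\mathcal{A}_i$ is regarded as a $C^{\ast}$-subalgebra of the direct sum $\mathcal{A}_1\oplus\mathcal{A}_2$ (componentwise operations, max norm), and $(P_1\oplus P_2)(a_1,a_2)=(P_1(a_1),P_2(a_2))$. A $C^{\ast}$-subalgebra is a norm-closed subalgebra closed under $\ast$ (no unit required). A Rota-Baxter operator of weight $\lambda\in\mathbb{C}$ on a $C^{\ast}$-algebra $\mathcal{A}$ is a linear map $P:\mathcal{A}\to\mathcal{A}$ with $P(a)P(b)=P(aP(b))+P(P(a)b)+\lambda P(ab)$ for all $a,b\in\mathcal{A}$. A Rota-Baxter $C^{\ast}$-algebra homomorphism $(\mathcal{A},P)\to(\mathcal{B},Q)$ (same weight) is a $\ast$-homomorphism $\phi:\mathcal{A}\to\mathcal{B}$ (unit preservation not required) with $\phi\circ P=Q\circ\phi$. Given a Rota-Baxter operator $P$ of weight $\lambda$ on $\mathcal{A}$, a Rota-Baxter operator $Q$ of weight $\lambda$ on $B(\mathcal{K})$ with $\mathcal{K}$ a Hilbert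 space, a Rota-Baxter $C^{\ast}$-algebra homomorphism $\pi:(\mathcal{A},P)\to(B(\mathcal{K}),Q)$ and a linear operator $f$ on $\mathcal{K}$, one says $\{\pi,\mathcal{K},f\}$ is a Rota-Baxter $\ast$-representation of (from) $(\mathcal{A},P)$ into $(B(\mathcal{K}),Q)$ if $Q$ matches $f$ on $\pi(\mathcal{A})$, i.e. $Q(b)(f(h))=f(Q(b)(h))+f(b(f(h)))+\lambda f(b(h))$ for all $b\in\pi(\mathcal{A})$, $h\in\mathcal{K}$; equivalently $\pi(P(a))(f(h))=f(\pi(P(a))(h))+f(\pi(a)(f(h)))+\lambda f(\pi(a)(h))$ for all $a\in\mathcal{A}$, $h\in\mathcal{K}$. *)

theory Defs
  imports "HOL-Analysis.Analysis"
begin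

text \<open>The inner product is linear in the first argument. Norm, topology and completeness are those
  of the class \<open>banach\<close>; \<open>cinner_self\<close> says that the norm comes from the inner product, and
  includes positive definiteness.\<close>

class complex_hilbert = banach +
  fixes scaleC :: "complex \<Rightarrow> 'a \<Rightarrow> 'a"  (infixr \<open>*\<^sub>C\<close> 75)
    and cinner :: "'a \<Rightarrow> 'a \<Rightarrow> complex"
  assumes scaleC_add_right: "c *\<^sub>C (x + y) = c *\<^sub>C x + c *\<^sub>C y"
    and scaleC_add_left: "(c + d) *\<^sub>C x = c *\<^sub>C x + d *\<^sub>C x"
    and scaleC_scaleC: "c *\<^sub>C d *\<^sub>C x = (c * d) *\<^sub>C x"
    and scaleR_scaleC: "r *\<^sub>R x = complex_of_real r *\<^sub>C x"
    and cinner_commute: "cinner x y = cnj (cinner y x)"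
    and cinner_add_left: "cinner (x + y) z = cinner x z + cinner y z"
    and cinner_scaleC_left: "cinner (c *\<^sub>C x) y = c * cinner x y"
    and cinner_self: "cinner x x = complex_of_real ((norm x)\<^sup>2)"

instantiation complex :: complex_hilbert
begin
definition scaleC_complex :: "complex \<Rightarrow> complex \<Rightarrow> complex" where "scaleC_complex c x = c * x"
definition cinner_complex :: "complex \<Rightarrow> complex \<Rightarrow> complex" where "cinner_complex x y = x * cnj y"
instance
  by standard (auto simp: scaleC_complex_def cinner_complex_def algebra_simps scaleR_conv_of_real
      complex_norm_square simp del: of_real_power)
end

text \<open>The product type carries the norm \<open>sqrt ((norm x)\<^sup>2 + (norm y)\<^sup>2)\<close>, so it is the Hilbert
  direct sum.\<close>

instantiation prod :: (complex_hilbert, complex_hilbert) complex_hilbert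
begin
definition scaleC_prod :: "complex \<Rightarrow> 'a \<times> 'b \<Rightarrow> 'a \<times> 'b"
  where "scaleC_prod c x = (c *\<^sub>C fst x, c *\<^sub>C snd x)"
definition cinner_prod :: "'a \<times> 'b \<Rightarrow> 'a \<times> 'b \<Rightarrow> complex"
  where "cinner_prod x y = cinner (fst x) (fst y) + cinner (snd x) (snd y)"
instance
proof
  fix x y :: "'a \<times> 'b"
  show "cinner x y = cnj (cinner y x)"
    unfolding cinner_prod_def by (metis cinner_commute complex_cnj_add)
qed (auto simp: scaleC_prod_def cinner_prod_def scaleC_add_right scaleC_add_left scaleC_scaleC
      scaleR_scaleC cinner_add_left cinner_scaleC_left cinner_self norm_prod_def algebra_simps
      prod_eq_iff simp flip: of_real_add of_real_power)
end

lemma scaleC_one [simp]: "1 *\<^sub>C (x::'a::complex_hilbert) = x"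
  by (metis of_real_1 scaleR_one scaleR_scaleC)

lemma scaleC_zero_left [simp]: "0 *\<^sub>C (x::'a::complex_hilbert) = 0"
  by (metis of_real_0 scaleR_zero_left scaleR_scaleC)

lemma scaleC_zero_right [simp]: "c *\<^sub>C (0::'a::complex_hilbert) = 0"
  using scaleC_add_right[of c "0::'a" 0] by simp

lemma scaleC_minus_one: "(-1) *\<^sub>C (x::'a::complex_hilbert) = - x"
  by (metis of_real_1 of_real_minus scaleR_minus1_left scaleR_scaleC)

lemma cinner_add_right: "cinner x (y + z) = cinner x y + cinner x (z::'a::complex_hilbert)"
  by (metis cinner_add_left cinner_commute complex_cnj_add)

lemma cinner_scaleC_right: "cinner x (c *\<^sub>C y) = cnj c * cinner x (y::'a::complex_hilbert)"
  by (metis cinner_commute cinner_scaleC_left complex_cnj_mult)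

lemma cinner_zero_left [simp]: "cinner 0 (x::'a::complex_hilbert) = 0"
  using cinner_add_left[of 0 0 x] by simp

lemma cinner_minus_left: "cinner (- x) y = - cinner x (y::'a::complex_hilbert)"
  using cinner_scaleC_left[of "-1" x y] by (simp add: scaleC_minus_one)

lemma cinner_diff_left: "cinner (x - y) z = cinner x z - cinner y (z::'a::complex_hilbert)"
  using cinner_add_left[of x "- y" z] by (simp add: cinner_minus_left)

lemma cinner_diff_right: "cinner x (y - z) = cinner x y - cinner x (z::'a::complex_hilbert)"
  by (metis cinner_diff_left cinner_commute complex_cnj_diff)

lemma norm_scaleC: "norm (c *\<^sub>C (x::'a::complex_hilbert)) = cmod c * norm x"
proof -
  have "complex_of_real ((norm (c *\<^sub>C x))\<^sup>2) = complex_of_real ((cmod c * norm x)\<^sup>2)"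
    unfolding cinner_self[symmetric] cinner_scaleC_left cinner_scaleC_right
    using complex_norm_square[of c]
    by (simp add: cinner_self power_mult_distrib mult.assoc[symmetric] del: complex_norm_square)
  then have "(norm (c *\<^sub>C x))\<^sup>2 = (cmod c * norm x)\<^sup>2" using of_real_eq_iff by blast
  then show ?thesis by (simp add: power2_eq_iff_nonneg)
qed

lemma norm2_add: "(norm (x + y::'a::complex_hilbert))\<^sup>2 = (norm x)\<^sup>2 + (norm y)\<^sup>2 + 2 * Re (cinner x y)"
proof -
  have "complex_of_real ((norm (x + y))\<^sup>2) = cinner x x + cinner y y + (cinner x y + cnj (cinner x y))"
    unfolding cinner_self[symmetric] by (simp add: cinner_add_left cinner_add_right cinner_commute[of y x])
  also have "\<dots> = complex_of_real ((norm x)\<^sup>2 + (norm y)\<^sup>2 + 2 * Re (cinner x y))"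
    by (simp add: cinner_self complex_add_cnj)
  finally show ?thesis using of_real_eq_iff by blast
qed

lemma cinner_eqI: "(\<And>z. cinner x z = cinner y z) \<Longrightarrow> x = (y::'a::complex_hilbert)"
proof -
  assume "\<And>z. cinner x z = cinner y z"
  then have "cinner (x - y) (x - y) = 0" by (simp add: cinner_diff_left)
  then show ?thesis by (simp add: cinner_self)
qed

lemma cinner_eqI_right: "(\<And>z. cinner z x = cinner z y) \<Longrightarrow> x = (y::'a::complex_hilbert)"
  by (metis cinner_commute cinner_eqI)

lemma cinner_Cauchy_Schwarz: "cmod (cinner x y) \<le> norm x * norm (y::'a::complex_hilbert)"
proof (cases "y = 0")
  case True
  then show ?thesis by (simp add: cinner_commute[of x])
next
  case False
  define c where "c = - cinner x y / complex_of_real ((norm y)\<^sup>2)"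
  have "0 \<le> (norm (x + c *\<^sub>C y))\<^sup>2" by simp
  also have "\<dots> = (norm x)\<^sup>2 + (cmod c * norm y)\<^sup>2 + 2 * Re (cnj c * cinner x y)"
    by (simp only: norm2_add norm_scaleC cinner_scaleC_right)
  also have "Re (cnj c * cinner x y) = - (cmod (cinner x y))\<^sup>2 / (norm y)\<^sup>2"
  proof -
    have "cnj c * cinner x y = - (cinner x y * cnj (cinner x y)) / complex_of_real ((norm y)\<^sup>2)"
      by (simp add: c_def)
    also have "\<dots> = complex_of_real (- (cmod (cinner x y))\<^sup>2 / (norm y)\<^sup>2)"
      by (simp add: complex_norm_square[symmetric])
    finally show ?thesis by (metis Re_complex_of_real)
  qed
  also have "(cmod c * norm y)\<^sup>2 = (cmod (cinner x y))\<^sup>2 / (norm y)\<^sup>2"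
  proof -
    have "cmod c = cmod (cinner x y) / (norm y)\<^sup>2"
      unfolding c_def norm_divide norm_minus_cancel norm_of_real by simp
    then show ?thesis using False by (simp add: field_simps power2_eq_square)
  qed
  finally have "(cmod (cinner x y))\<^sup>2 / (norm y)\<^sup>2 \<le> (norm x)\<^sup>2" by simp
  then have "(cmod (cinner x y))\<^sup>2 \<le> (norm x * norm y)\<^sup>2"
    using False by (simp add: field_simps power_mult_distrib)
  then show ?thesis by (rule power2_le_imp_le) simp
qed


definition clinear :: "('a::complex_hilbert \<Rightarrow> 'b::complex_hilbert) \<Rightarrow> bool" where
  "clinear T \<longleftrightarrow> (\<forall>x y. T (x + y) = T x + T y) \<and> (\<forall>c x. T (c *\<^sub>C x) = c *\<^sub>C T x)"

definition bounded_clinear :: "('a::complex_hilbert \<Rightarrow> 'b::complex_hilbert) \<Rightarrow> bool" where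
  "bounded_clinear T \<longleftrightarrow> clinear T \<and> (\<exists>K. \<forall>x. norm (T x) \<le> K * norm x)"

definition adjoint_op :: "('a::complex_hilbert \<Rightarrow> 'b::complex_hilbert) \<Rightarrow> 'b \<Rightarrow> 'a" where
  "adjoint_op T = (THE S. bounded_clinear S \<and> (\<forall>x y. cinner (T x) y = cinner x (S y)))"

lemma bounded_clinear_iff:
  "bounded_clinear T \<longleftrightarrow> bounded_linear T \<and> (\<forall>c x. T (c *\<^sub>C x) = c *\<^sub>C T x)"
  unfolding bounded_clinear_def clinear_def bounded_linear_def bounded_linear_axioms_def linear_iff
  by (auto simp: scaleR_scaleC mult.commute)

lemma Riesz_representation:
  fixes f :: "'a::complex_hilbert \<Rightarrow> complex"
  assumes add: "\<And>x y. f (x + y) = f x + f y" and scale: "\<And>c x. f (c *\<^sub>C x) = c * f x"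
    and bound: "\<And>x. cmod (f x) \<le> K * norm x"
  shows "\<exists>y. \<forall>x. f x = cinner x y"
proof -
  define \<phi> where "\<phi> x = (norm x)\<^sup>2 - 2 * Re (f x)" for x
  have f_minus: "f (- x) = - f x" for x using scale[of "-1" x] by (simp add: scaleC_minus_one)
  have f_diff: "f (x - y) = f x - f y" for x y using add[of x "- y"] by (simp add: f_minus)
  have f_R: "f (r *\<^sub>R x) = of_real r * f x" for r x by (simp add: scaleR_scaleC scale)
  have Re_bound: "Re (f x) \<le> K * norm x" for x
    using bound[of x] complex_Re_le_cmod[of "f x"] by linarith
  have lower: "\<phi> x \<ge> - K\<^sup>2" for x
  proof -
    have "0 \<le> (norm x - K)\<^sup>2" by simp
    then show ?thesis using Re_bound[of x] by (simp add: \<phi>_def power2_eq_square algebra_simps)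
  qed
  define m where "m = Inf (range \<phi>)"
  have bdd: "bdd_below (range \<phi>)" using lower by (auto intro!: bdd_belowI)
  have m_le: "m \<le> \<phi> x" for x unfolding m_def using bdd by (simp add: cInf_lower)
  have "\<exists>x. \<phi> x < m + inverse (real (Suc n))" for n
  proof -
    have "Inf (range \<phi>) < m + inverse (real (Suc n))" by (simp add: m_def)
    then show ?thesis using cInf_lessD[of "range \<phi>"] by blast
  qed
  then obtain X where X: "\<And>n. \<phi> (X n) < m + inverse (real (Suc n))" by metis
  have mid: "(norm (x - y))\<^sup>2 = 2 * \<phi> x + 2 * \<phi> y - 4 * \<phi> ((1/2) *\<^sub>R (x + y))" for x y
  proof -
    have a: "(norm (x - y))\<^sup>2 = (norm x)\<^sup>2 + (norm y)\<^sup>2 - 2 * Re (cinner x y)"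
      using norm2_add[of x "- y"] cinner_diff_right[of x 0 y] by (simp add: cinner_commute[of x 0])
    have b: "(norm ((1/2) *\<^sub>R (x + y)))\<^sup>2 = (norm (x + y))\<^sup>2 / 4"
      unfolding norm_scaleR power_mult_distrib by (simp add: power2_eq_square)
    have c: "Re (of_real (1/2) * (f x + f y)) = (Re (f x) + Re (f y)) / 2" by simp
    show ?thesis unfolding \<phi>_def b a norm2_add f_R add c by (simp add: field_simps)
  qed
  have close: "(norm (x - y))\<^sup>2 \<le> 2 * (\<phi> x - m) + 2 * (\<phi> y - m)" for x y
  proof -
    define p where "p = \<phi> ((1/2) *\<^sub>R (x + y))"
    have "m \<le> p" "(norm (x - y))\<^sup>2 = 2 * \<phi> x + 2 * \<phi> y - 4 * p"
      unfolding p_def by (rule m_le, rule mid)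
    then show ?thesis by argo
  qed
  have "Cauchy X"
  proof (rule CauchyI)
    fix e :: real assume e: "0 < e"
    obtain N where N: "inverse (real (Suc N)) < e\<^sup>2 / 4"
      using reals_Archimedean[of "e\<^sup>2 / 4"] e by auto
    have "norm (X k - X n) < e" if "k \<ge> N" "n \<ge> N" for k n
    proof -
      have "inverse (real (Suc k)) \<le> inverse (real (Suc N))" "inverse (real (Suc n)) \<le> inverse (real (Suc N))"
        using that by (simp_all add: le_imp_inverse_le)
      then have "(norm (X k - X n))\<^sup>2 < e\<^sup>2" using close[of "X k" "X n"] X[of k] X[of n] N by argo
      then show ?thesis using e by (simp add: power2_less_imp_less)
    qed
    then show "\<exists>M. \<forall>k\<ge>M. \<forall>n\<ge>M. norm (X k - X n) < e" by blast
  qed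
  then obtain y where y: "X \<longlonglongrightarrow> y" using Cauchy_convergent_iff convergent_def by blast
  have "bounded_linear f"
    by (rule bounded_linear_intro[where K=K]) (auto simp: add f_R bound scaleR_conv_of_real mult.commute)
  then have "(\<lambda>n. f (X n)) \<longlonglongrightarrow> f y" using y by (rule bounded_linear.tendsto)
  then have "(\<lambda>n. \<phi> (X n)) \<longlonglongrightarrow> \<phi> y" unfolding \<phi>_def using y by (intro tendsto_intros)
  moreover have "(\<lambda>n. m + inverse (real (Suc n))) \<longlonglongrightarrow> m + 0"
    by (intro tendsto_intros LIMSEQ_inverse_real_of_nat)
  ultimately have "\<phi> y \<le> m + 0"
    using X by (intro LIMSEQ_le) (auto intro: less_imp_le)
  then have min: "\<phi> y \<le> \<phi> x" for x using m_le[of x] by linarith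
  have Re_eq: "Re (f x) = Re (cinner x y)" for x
  proof -
    define d where "d = Re (cinner y x) - Re (f x)"
    have *: "0 \<le> t\<^sup>2 * (norm x)\<^sup>2 + 2 * t * d" for t
    proof -
      have "\<phi> (y + t *\<^sub>R x) = \<phi> y + t\<^sup>2 * (norm x)\<^sup>2 + 2 * t * d"
        unfolding \<phi>_def d_def norm2_add add f_R
        by (simp add: scaleR_scaleC cinner_scaleC_right norm_scaleC power_mult_distrib algebra_simps)
      then show ?thesis using min[of "y + t *\<^sub>R x"] by linarith
    qed
    have "d = 0"
    proof (rule ccontr)
      assume d: "d \<noteq> 0"
      define s where "s = (norm x)\<^sup>2 + 1"
      have s: "s > 0" by (simp add: s_def add_nonneg_pos)
      have "(d / s)\<^sup>2 * (norm x)\<^sup>2 - 2 * (d / s) * d \<ge> 0" using *[of "- d / s"] by simp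
      then have "((d / s)\<^sup>2 * (norm x)\<^sup>2 - 2 * (d / s) * d) * s\<^sup>2 \<ge> 0" by simp
      also have "((d / s)\<^sup>2 * (norm x)\<^sup>2 - 2 * (d / s) * d) * s\<^sup>2 = d\<^sup>2 * ((norm x)\<^sup>2 - 2 * s)"
        using s by (simp add: field_simps power2_eq_square)
      finally have "0 \<le> d\<^sup>2 * ((norm x)\<^sup>2 - 2 * s)" .
      moreover have "(norm x)\<^sup>2 - 2 * s < 0"
        unfolding s_def using zero_le_power2[of "norm x"] by argo
      ultimately show False using d by (simp add: zero_le_mult_iff)
    qed
    then show ?thesis unfolding d_def by (simp add: cinner_commute[of y x])
  qed
  have "f x = cinner x y" for x
  proof (rule complex_eqI)
    show "Re (f x) = Re (cinner x y)" by (rule Re_eq)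
    show "Im (f x) = Im (cinner x y)"
      using Re_eq[of "\<i> *\<^sub>C x"] by (simp add: scale cinner_scaleC_left)
  qed
  then show ?thesis by blast
qed

lemma adjoint_op_unique:
  assumes "bounded_clinear S" "\<And>x y. cinner (T x) y = cinner x (S y)"
  shows "adjoint_op T = S"
  unfolding adjoint_op_def
proof (rule the_equality)
  fix S' assume S': "bounded_clinear S' \<and> (\<forall>x y. cinner (T x) y = cinner x (S' y))"
  show "S' = S"
  proof
    fix y
    have "cinner x (S' y) = cinner x (S y)" for x using S' assms(2) by metis
    then show "S' y = S y" by (rule cinner_eqI_right)
  qed
qed (use assms in auto)

lemma adjoint_op_exists:
  assumes "bounded_clinear T"
  shows "\<exists>S. bounded_clinear S \<and> (\<forall>x y. cinner (T x) y = cinner x (S y))"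
proof -
  have lin: "clinear T" using assms by (simp add: bounded_clinear_def)
  have bl: "bounded_linear T" using assms by (simp add: bounded_clinear_iff)
  obtain K where K: "\<And>x. norm (T x) \<le> norm x * K" "0 \<le> K"
    using bounded_linear.nonneg_bounded[OF bl] by blast
  have "\<exists>s. \<forall>x. cinner (T x) y = cinner x s" for y
  proof (rule Riesz_representation[where K = "K * norm y"])
    show "cmod (cinner (T x) y) \<le> K * norm y * norm x" for x
      using cinner_Cauchy_Schwarz[of "T x" y] mult_right_mono[OF K(1)[of x], of "norm y"]
      by (simp add: algebra_simps)
  qed (use lin in \<open>simp_all add: clinear_def cinner_add_left cinner_scaleC_left\<close>)
  then obtain S where S: "\<And>x y. cinner (T x) y = cinner x (S y)" by metis
  have "S (x + y) = S x + S y" for x y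
    by (rule cinner_eqI_right) (simp add: S[symmetric] cinner_add_right)
  moreover have "S (c *\<^sub>C x) = c *\<^sub>C S x" for c x
    by (rule cinner_eqI_right) (simp add: S[symmetric] cinner_scaleC_right)
  moreover have "norm (S x) \<le> K * norm x" for x
  proof (cases "S x = 0")
    case False
    have "(norm (S x))\<^sup>2 = cmod (cinner (S x) (S x))" by (simp add: cinner_self norm_power)
    also have "\<dots> = cmod (cinner (T (S x)) x)" by (simp add: S)
    also have "\<dots> \<le> norm (S x) * K * norm x"
      using cinner_Cauchy_Schwarz[of "T (S x)" x] mult_right_mono[OF K(1)[of "S x"], of "norm x"] by simp
    finally show ?thesis using False by (simp add: power2_eq_square mult.assoc)
  qed (use K in simp)
  ultimately have "bounded_clinear S" unfolding bounded_clinear_def clinear_def by blast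
  then show ?thesis using S by blast
qed

lemma
  assumes "bounded_clinear T"
  shows bounded_clinear_adjoint_op: "bounded_clinear (adjoint_op T)"
    and cinner_adjoint_op: "cinner (T x) y = cinner x (adjoint_op T y)"
  using adjoint_op_exists[OF assms] adjoint_op_unique by (metis, metis)


record 'a star_algebra =
  carr :: "'a set"
  azero :: 'a
  aadd :: "'a \<Rightarrow> 'a \<Rightarrow> 'a"
  ascale :: "complex \<Rightarrow> 'a \<Rightarrow> 'a"
  amult :: "'a \<Rightarrow> 'a \<Rightarrow> 'a"
  astar :: "'a \<Rightarrow> 'a"
  anorm :: "'a \<Rightarrow> real"

definition adist :: "'a star_algebra \<Rightarrow> 'a \<Rightarrow> 'a \<Rightarrow> real" where
  "adist A x y = anorm A (aadd A x (ascale A (-1) y))"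

text \<open>No unit is required. Additive inverses are \<open>ascale A (-1) x\<close>, by \<open>scale_zero\<close> and
  \<open>scale_add_left\<close>.\<close>

locale cstar_algebra =
  fixes A :: "'a star_algebra"
  assumes zero_closed: "azero A \<in> carr A"
    and add_closed: "\<lbrakk>x \<in> carr A; y \<in> carr A\<rbrakk> \<Longrightarrow> aadd A x y \<in> carr A"
    and scale_closed: "x \<in> carr A \<Longrightarrow> ascale A c x \<in> carr A"
    and mult_closed: "\<lbrakk>x \<in> carr A; y \<in> carr A\<rbrakk> \<Longrightarrow> amult A x y \<in> carr A"
    and star_closed: "x \<in> carr A \<Longrightarrow> astar A x \<in> carr A"
    and add_assoc: "\<lbrakk>x \<in> carr A; y \<in> carr A; z \<in> carr A\<rbrakk> \<Longrightarrow>
      aadd A (aadd A x y) z = aadd A x (aadd A y z)"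
    and add_commute: "\<lbrakk>x \<in> carr A; y \<in> carr A\<rbrakk> \<Longrightarrow> aadd A x y = aadd A y x"
    and add_zero: "x \<in> carr A \<Longrightarrow> aadd A (azero A) x = x"
    and scale_one: "x \<in> carr A \<Longrightarrow> ascale A 1 x = x"
    and scale_zero: "x \<in> carr A \<Longrightarrow> ascale A 0 x = azero A"
    and scale_scale: "x \<in> carr A \<Longrightarrow> ascale A c (ascale A d x) = ascale A (c * d) x"
    and scale_add_right: "\<lbrakk>x \<in> carr A; y \<in> carr A\<rbrakk> \<Longrightarrow>
      ascale A c (aadd A x y) = aadd A (ascale A c x) (ascale A c y)"
    and scale_add_left: "x \<in> carr A \<Longrightarrow>
      ascale A (c + d) x = aadd A (ascale A c x) (ascale A d x)"
    and mult_assoc: "\<lbrakk>x \<in> carr A; y \<in> carr A; z \<in> carr A\<rbrakk> \<Longrightarrow>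
      amult A (amult A x y) z = amult A x (amult A y z)"
    and mult_add_left: "\<lbrakk>x \<in> carr A; y \<in> carr A; z \<in> carr A\<rbrakk> \<Longrightarrow>
      amult A (aadd A x y) z = aadd A (amult A x z) (amult A y z)"
    and mult_add_right: "\<lbrakk>x \<in> carr A; y \<in> carr A; z \<in> carr A\<rbrakk> \<Longrightarrow>
      amult A x (aadd A y z) = aadd A (amult A x y) (amult A x z)"
    and mult_scale_left: "\<lbrakk>x \<in> carr A; y \<in> carr A\<rbrakk> \<Longrightarrow>
      amult A (ascale A c x) y = ascale A c (amult A x y)"
    and mult_scale_right: "\<lbrakk>x \<in> carr A; y \<in> carr A\<rbrakk> \<Longrightarrow>
      amult A x (ascale A c y) = ascale A c (amult A x y)"
    and star_star: "x \<in> carr A \<Longrightarrow> astar A (astar A x) = x"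
    and star_add: "\<lbrakk>x \<in> carr A; y \<in> carr A\<rbrakk> \<Longrightarrow>
      astar A (aadd A x y) = aadd A (astar A x) (astar A y)"
    and star_scale: "x \<in> carr A \<Longrightarrow> astar A (ascale A c x) = ascale A (cnj c) (astar A x)"
    and star_mult: "\<lbrakk>x \<in> carr A; y \<in> carr A\<rbrakk> \<Longrightarrow>
      astar A (amult A x y) = amult A (astar A y) (astar A x)"
    and norm_nonneg: "x \<in> carr A \<Longrightarrow> 0 \<le> anorm A x"
    and norm_eq_zero: "x \<in> carr A \<Longrightarrow> anorm A x = 0 \<longleftrightarrow> x = azero A"
    and norm_add: "\<lbrakk>x \<in> carr A; y \<in> carr A\<rbrakk> \<Longrightarrow> anorm A (aadd A x y) \<le> anorm A x + anorm A y"
    and norm_scale: "x \<in> carr A \<Longrightarrow> anorm A (ascale A c x) = cmod c * anorm A x"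
    and norm_mult: "\<lbrakk>x \<in> carr A; y \<in> carr A\<rbrakk> \<Longrightarrow> anorm A (amult A x y) \<le> anorm A x * anorm A y"
    and cstar_identity: "x \<in> carr A \<Longrightarrow> anorm A (amult A (astar A x) x) = (anorm A x)\<^sup>2"
    and complete: "\<lbrakk>\<And>n. X n \<in> carr A; \<And>e. e > 0 \<Longrightarrow> \<exists>N. \<forall>m\<ge>N. \<forall>n\<ge>N. adist A (X m) (X n) < e\<rbrakk> \<Longrightarrow>
      \<exists>L\<in>carr A. (\<lambda>n. adist A (X n) L) \<longlonglongrightarrow> 0"

definition cstar_subalgebra :: "'a star_algebra \<Rightarrow> 'a star_algebra \<Rightarrow> bool" where
  "cstar_subalgebra A B \<longleftrightarrow>
     cstar_algebra B \<and> A = B\<lparr>carr := carr A\<rparr> \<and> carr A \<subseteq> carr B \<and>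
     azero B \<in> carr A \<and>
     (\<forall>x\<in>carr A. \<forall>y\<in>carr A. aadd B x y \<in> carr A) \<and>
     (\<forall>c. \<forall>x\<in>carr A. ascale B c x \<in> carr A) \<and>
     (\<forall>x\<in>carr A. \<forall>y\<in>carr A. amult B x y \<in> carr A) \<and>
     (\<forall>x\<in>carr A. astar B x \<in> carr A) \<and>
     (\<forall>X. \<forall>L\<in>carr B. (\<forall>n. X n \<in> carr A) \<longrightarrow> (\<lambda>n. adist B (X n) L) \<longlonglongrightarrow> 0 \<longrightarrow> L \<in> carr A)"

definition bounded_operators :: "('a::complex_hilbert \<Rightarrow> 'a) star_algebra"  (\<open>\<B>\<close>) where
  "\<B> = \<lparr>carr = {T. bounded_clinear T}, azero = (\<lambda>_. 0), aadd = (\<lambda>S T x. S x + T x),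
        ascale = (\<lambda>c T x. c *\<^sub>C T x), amult = (\<lambda>S T. S \<circ> T), astar = adjoint_op, anorm = onorm\<rparr>"

definition direct_sum :: "'a star_algebra \<Rightarrow> 'b star_algebra \<Rightarrow> ('a \<times> 'b) star_algebra"
    (infixr \<open>\<oplus>\<^sub>*\<close> 65) where
  "A \<oplus>\<^sub>* B = \<lparr>carr = carr A \<times> carr B, azero = (azero A, azero B),
     aadd = (\<lambda>(a, b) (a', b'). (aadd A a a', aadd B b b')),
     ascale = (\<lambda>c. map_prod (ascale A c) (ascale B c)),
     amult = (\<lambda>(a, b) (a', b'). (amult A a a', amult B b b')),
     astar = map_prod (astar A) (astar B),
     anorm = (\<lambda>(a, b). max (anorm A a) (anorm B b))\<rparr>"

lemma cstar_algebra_subalgebra: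
  assumes "cstar_subalgebra A B"
  shows "cstar_algebra A"
proof -
  interpret B: cstar_algebra B using assms by (simp add: cstar_subalgebra_def)
  define S where "S = carr A"
  have A: "A = B\<lparr>carr := S\<rparr>" and S: "S \<subseteq> carr B" and z: "azero B \<in> S"
    and cl: "\<And>x y. x \<in> S \<Longrightarrow> y \<in> S \<Longrightarrow> aadd B x y \<in> S" "\<And>c x. x \<in> S \<Longrightarrow> ascale B c x \<in> S"
      "\<And>x y. x \<in> S \<Longrightarrow> y \<in> S \<Longrightarrow> amult B x y \<in> S" "\<And>x. x \<in> S \<Longrightarrow> astar B x \<in> S"
    and lim: "\<And>X L. L \<in> carr B \<Longrightarrow> (\<And>n. X n \<in> S) \<Longrightarrow> (\<lambda>n. adist B (X n) L) \<longlonglongrightarrow> 0 \<Longrightarrow> L \<in> S"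
    using assms unfolding cstar_subalgebra_def S_def by blast+
  have sel: "carr A = S" "azero A = azero B" "aadd A = aadd B" "ascale A = ascale B"
    "amult A = amult B" "astar A = astar B" "anorm A = anorm B" by (simp_all add: A)
  have ad: "adist A = adist B" by (simp add: fun_eq_iff adist_def sel)
  show ?thesis
  proof (unfold_locales, unfold sel ad)
    fix X :: "nat \<Rightarrow> 'a" assume X: "\<And>n. X n \<in> S" and C: "\<And>e::real. e > 0 \<Longrightarrow> \<exists>N. \<forall>m\<ge>N. \<forall>n\<ge>N. adist B (X m) (X n) < e"
    obtain L where L: "L \<in> carr B" "(\<lambda>n. adist B (X n) L) \<longlonglongrightarrow> 0"
      using B.complete[of X] X S C by blast
    then show "\<exists>L\<in>S. (\<lambda>n. adist B (X n) L) \<longlonglongrightarrow> 0" using lim X by blast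
  qed (use S in \<open>simp_all add: z cl subset_iff B.add_assoc B.add_zero B.scale_one B.scale_zero
      B.scale_scale B.scale_add_right B.scale_add_left B.mult_assoc B.mult_add_left
      B.mult_add_right B.mult_scale_left B.mult_scale_right B.star_star B.star_add B.star_scale
      B.star_mult B.norm_nonneg B.norm_eq_zero B.norm_add B.norm_scale B.norm_mult B.cstar_identity\<close>,
      simp_all add: B.add_commute)
qed

lemma cstar_algebra_bounded_operators: "cstar_algebra (\<B> :: ('a::complex_hilbert \<Rightarrow> 'a) star_algebra)"
proof -
  let ?bc = "bounded_clinear :: ('a \<Rightarrow> 'a) \<Rightarrow> bool"
  have ad: "adist \<B> S T = onorm (\<lambda>x. S x - T x)" for S T :: "'a \<Rightarrow> 'a"
    by (simp add: adist_def bounded_operators_def scaleC_minus_one)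
  have bl: "bounded_linear T" if "?bc T" for T using that by (simp add: bounded_clinear_iff)
  have onorm_scaleC: "onorm (\<lambda>x. c *\<^sub>C T x) = cmod c * onorm T" if "?bc T" for c T
  proof -
    have "onorm (\<lambda>x. c *\<^sub>C T x) = onorm (\<lambda>x. cmod c *\<^sub>R T x)"
      by (simp add: onorm_def norm_scaleC)
    then show ?thesis using onorm_scaleR[OF bl[OF that], of "cmod c"] by simp
  qed
  have norm_sq: "(onorm T)\<^sup>2 \<le> onorm (adjoint_op T \<circ> T)" if T: "?bc T" for T
  proof -
    note aT = bounded_clinear_adjoint_op[OF T]
    let ?N = "onorm (adjoint_op T \<circ> T)"
    have b: "bounded_linear (adjoint_op T \<circ> T)"
      using bounded_linear_compose[OF bl[OF aT] bl[OF T]] by (simp add: o_def)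
    have N: "0 \<le> ?N" by (rule onorm_pos_le[OF b])
    have "norm (T x) \<le> sqrt ?N * norm x" for x
    proof -
      have "(norm (T x))\<^sup>2 = cmod (cinner (T x) (T x))" by (simp add: cinner_self norm_power)
      also have "\<dots> = cmod (cinner x (adjoint_op T (T x)))" by (simp add: cinner_adjoint_op[OF T])
      also have "\<dots> \<le> norm x * norm (adjoint_op T (T x))" by (rule cinner_Cauchy_Schwarz)
      also have "\<dots> \<le> norm x * (?N * norm x)" using onorm[OF b, of x] by (simp add: mult_left_mono)
      also have "\<dots> = (sqrt ?N * norm x)\<^sup>2" using N by (simp add: power_mult_distrib power2_eq_square)
      finally show ?thesis by (rule power2_le_imp_le) (use N in simp)
    qed
    then have "onorm T \<le> sqrt ?N" by (rule onorm_bound[rotated]) (use N in simp)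
    then show ?thesis using N onorm_pos_le[OF bl[OF T]] by (metis real_sqrt_pow2 power_mono)
  qed
  have adj_adj: "adjoint_op (adjoint_op T) = T" if T: "?bc T" for T
    by (rule adjoint_op_unique[OF T]) (metis cinner_adjoint_op[OF T] cinner_commute)
  have adj_le: "onorm T \<le> onorm (adjoint_op T)" if T: "?bc T" for T
  proof (cases "onorm T = 0")
    case True
    then show ?thesis using onorm_pos_le[OF bl[OF bounded_clinear_adjoint_op[OF T]]] by simp
  next
    case False
    have "(onorm T)\<^sup>2 \<le> onorm (adjoint_op T) * onorm T"
      using norm_sq[OF T] onorm_compose[OF bl[OF bounded_clinear_adjoint_op[OF T]] bl[OF T]] by linarith
    then show ?thesis using False onorm_pos_le[OF bl[OF T]] by (simp add: power2_eq_square)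
  qed
  have adj_norm: "onorm (adjoint_op T) = onorm T" if T: "?bc T" for T
    using adj_le[OF T] adj_le[OF bounded_clinear_adjoint_op[OF T]] by (simp add: adj_adj[OF T])
  have closed: "?bc (\<lambda>_. 0)" "\<And>S T. ?bc S \<Longrightarrow> ?bc T \<Longrightarrow> ?bc (\<lambda>x. S x + T x)"
    "\<And>c T. ?bc T \<Longrightarrow> ?bc (\<lambda>x. c *\<^sub>C T x)" "\<And>S T. ?bc S \<Longrightarrow> ?bc T \<Longrightarrow> ?bc (S \<circ> T)"
  proof -
    show "?bc (\<lambda>_. 0)" by (auto simp: bounded_clinear_iff)
    show "?bc (\<lambda>x. S x + T x)" if "?bc S" "?bc T" for S T
      using that by (auto simp: bounded_clinear_iff bounded_linear_add scaleC_add_right)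
    show "?bc (S \<circ> T)" if "?bc S" "?bc T" for S T
      using that bounded_linear_compose[of S T] by (auto simp: bounded_clinear_iff o_def)
    show "?bc (\<lambda>x. c *\<^sub>C T x)" if T: "?bc T" for c T
      unfolding bounded_clinear_def clinear_def
    proof (intro conjI allI exI)
      show "norm (c *\<^sub>C T x) \<le> (cmod c * onorm T) * norm x" for x
        using mult_left_mono[OF onorm[OF bl[OF T], of x], of "cmod c"] by (simp add: norm_scaleC mult.assoc)
    qed (use T in \<open>simp_all add: bounded_clinear_def clinear_def scaleC_add_right scaleC_scaleC mult.commute\<close>)
  qed
  show ?thesis
  proof (unfold_locales, unfold ad, unfold bounded_operators_def star_algebra.simps mem_Collect_eq)
    fix T assume T: "?bc T"
    note aT = bounded_clinear_adjoint_op[OF T]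
    show "onorm (adjoint_op T \<circ> T) = (onorm T)\<^sup>2"
      using norm_sq[OF T] onorm_compose[OF bl[OF aT] bl[OF T]] adj_norm[OF T] by (simp add: power2_eq_square)
    show "adjoint_op (\<lambda>x. c *\<^sub>C T x) = (\<lambda>x. cnj c *\<^sub>C adjoint_op T x)" for c
      by (rule adjoint_op_unique[OF closed(3)[OF aT]])
        (simp add: cinner_scaleC_left cinner_scaleC_right cinner_adjoint_op[OF T])
    show "onorm T = 0 \<longleftrightarrow> T = (\<lambda>_. 0)" using onorm_eq_0[OF bl[OF T]] by (auto simp: fun_eq_iff)
    show "(\<lambda>x. c *\<^sub>C d *\<^sub>C T x) = (\<lambda>x. (c * d) *\<^sub>C T x)" for c d by (simp add: scaleC_scaleC)
    show "(\<lambda>x. (c + d) *\<^sub>C T x) = (\<lambda>x. c *\<^sub>C T x + d *\<^sub>C T x)" for c d by (simp add: scaleC_add_left)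
    fix S assume S: "?bc S"
    note aS = bounded_clinear_adjoint_op[OF S]
    show "adjoint_op (\<lambda>x. T x + S x) = (\<lambda>x. adjoint_op T x + adjoint_op S x)"
      by (rule adjoint_op_unique[OF closed(2)[OF aT aS]])
        (simp add: cinner_add_left cinner_add_right cinner_adjoint_op[OF T] cinner_adjoint_op[OF S])
    show "adjoint_op (T \<circ> S) = adjoint_op S \<circ> adjoint_op T"
      by (rule adjoint_op_unique[OF closed(4)[OF aS aT]])
        (simp add: cinner_adjoint_op[OF T] cinner_adjoint_op[OF S])
  next
    fix X :: "nat \<Rightarrow> 'a \<Rightarrow> 'a"
    assume X: "\<And>n. ?bc (X n)"
      and C: "\<And>e::real. e > 0 \<Longrightarrow> \<exists>N. \<forall>m\<ge>N. \<forall>n\<ge>N. onorm (\<lambda>x. X m x - X n x) < e"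
    define Y where "Y n = Blinfun (X n)" for n
    have Y: "blinfun_apply (Y n) = X n" for n
      by (simp add: Y_def bounded_linear_Blinfun_apply[OF bl[OF X]])
    have nrm: "norm (Y m - Z) = onorm (\<lambda>x. X m x - blinfun_apply Z x)" for m Z
      by (simp add: norm_blinfun.rep_eq minus_blinfun.rep_eq Y)
    have "Cauchy Y" by (rule CauchyI) (use C in \<open>simp add: nrm Y\<close>)
    then obtain Z where Z: "Y \<longlonglongrightarrow> Z" using Cauchy_convergent_iff convergent_def by blast
    have ptw: "(\<lambda>n. X n x) \<longlonglongrightarrow> blinfun_apply Z x" for x
      using blinfun.tendsto[OF Z tendsto_const[of x]] by (simp add: Y)
    have "blinfun_apply Z (c *\<^sub>C x) = c *\<^sub>C blinfun_apply Z x" for c x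
    proof (rule LIMSEQ_unique[OF ptw])
      have "bounded_linear (\<lambda>x::'a. c *\<^sub>C x)"
        by (rule bounded_linear_intro[where K="cmod c"])
          (auto simp: scaleC_add_right scaleR_scaleC scaleC_scaleC norm_scaleC mult.commute)
      from bounded_linear.tendsto[OF this ptw[of x]]
      show "(\<lambda>n. X n (c *\<^sub>C x)) \<longlonglongrightarrow> c *\<^sub>C blinfun_apply Z x"
        using X by (simp add: bounded_clinear_iff)
    qed
    then have "?bc (blinfun_apply Z)" by (simp add: bounded_clinear_iff blinfun.bounded_linear_right)
    moreover have "(\<lambda>n. onorm (\<lambda>x. X n x - blinfun_apply Z x)) \<longlonglongrightarrow> 0"
      using tendsto_norm_zero[OF LIM_zero[OF Z]] by (simp add: nrm)
    ultimately show "\<exists>L\<in>{T. bounded_clinear T}. (\<lambda>n. onorm (\<lambda>x. X n x - L x)) \<longlonglongrightarrow> 0" by blast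
  qed (auto simp: closed bounded_clinear_adjoint_op adj_adj fun_eq_iff scaleC_add_right algebra_simps
      onorm_scaleC onorm_pos_le[OF bl] onorm_triangle[OF bl bl] onorm_compose[OF bl bl],
      auto simp: bounded_clinear_def clinear_def)
qed

lemma cstar_algebra_direct_sum:
  assumes "cstar_algebra A" "cstar_algebra B"
  shows "cstar_algebra (A \<oplus>\<^sub>* B)"
proof -
  interpret A: cstar_algebra A by fact
  interpret B: cstar_algebra B by fact
  have ad: "adist (A \<oplus>\<^sub>* B) x y = max (adist A (fst x) (fst y)) (adist B (snd x) (snd y))" for x y
    by (cases x; cases y) (simp add: adist_def direct_sum_def)
  have nn: "0 \<le> adist A x y" if "x \<in> carr A" "y \<in> carr A" for x y
    unfolding adist_def using that by (intro A.norm_nonneg A.add_closed A.scale_closed)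
  have nn': "0 \<le> adist B x y" if "x \<in> carr B" "y \<in> carr B" for x y
    unfolding adist_def using that by (intro B.norm_nonneg B.add_closed B.scale_closed)
  show ?thesis
  proof (unfold_locales, unfold ad, unfold direct_sum_def star_algebra.simps)
    fix x y assume x: "x \<in> carr A \<times> carr B" and y: "y \<in> carr A \<times> carr B"
    obtain a b a' b' where xy: "x = (a, b)" "y = (a', b')" by (metis surj_pair)
    show "(case (case x of (a, b) \<Rightarrow> \<lambda>(a', b'). (aadd A a a', aadd B b b')) y of
        (a, b) \<Rightarrow> max (anorm A a) (anorm B b)) \<le>
      (case x of (a, b) \<Rightarrow> max (anorm A a) (anorm B b)) + (case y of (a, b) \<Rightarrow> max (anorm A a) (anorm B b))"
      using x y A.norm_add[of a a'] B.norm_add[of b b'] by (auto simp: xy)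
    have "anorm A a * anorm A a' \<le> max (anorm A a) (anorm B b) * max (anorm A a') (anorm B b')"
      "anorm B b * anorm B b' \<le> max (anorm A a) (anorm B b) * max (anorm A a') (anorm B b')"
      using x y by (auto intro!: mult_mono simp: xy A.norm_nonneg B.norm_nonneg le_max_iff_disj)
    then show "(case (case x of (a, b) \<Rightarrow> \<lambda>(a', b'). (amult A a a', amult B b b')) y of
        (a, b) \<Rightarrow> max (anorm A a) (anorm B b)) \<le>
      (case x of (a, b) \<Rightarrow> max (anorm A a) (anorm B b)) * (case y of (a, b) \<Rightarrow> max (anorm A a) (anorm B b))"
      using x y A.norm_mult[of a a'] B.norm_mult[of b b'] by (auto simp: xy)
  next
    fix x assume x: "x \<in> carr A \<times> carr B"
    obtain a b where xy: "x = (a, b)" by (metis surj_pair)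
    have a: "a \<in> carr A" "b \<in> carr B" using x xy by auto
    have nna: "0 \<le> anorm A a" "0 \<le> anorm B b" using a by (auto intro: A.norm_nonneg B.norm_nonneg)
    show "((case x of (a, b) \<Rightarrow> max (anorm A a) (anorm B b)) = 0) = (x = (azero A, azero B))"
      using nna a by (auto simp: xy A.norm_eq_zero[symmetric] B.norm_eq_zero[symmetric] max_def)
    have "max ((anorm A a)\<^sup>2) ((anorm B b)\<^sup>2) = (max (anorm A a) (anorm B b))\<^sup>2"
      using nna by (auto simp: max_def power2_le_iff_abs_le power_mono dest: power2_le_imp_le)
    then show "(case (case map_prod (astar A) (astar B) x of (a, b) \<Rightarrow> \<lambda>(a', b'). (amult A a a', amult B b b')) x of
        (a, b) \<Rightarrow> max (anorm A a) (anorm B b)) = (case x of (a, b) \<Rightarrow> max (anorm A a) (anorm B b))\<^sup>2"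
      using a by (simp add: xy A.cstar_identity B.cstar_identity)
    show "(case map_prod (ascale A c) (ascale B c) x of (a, b) \<Rightarrow> max (anorm A a) (anorm B b)) =
      cmod c * (case x of (a, b) \<Rightarrow> max (anorm A a) (anorm B b))" for c
      using a by (simp add: xy A.norm_scale B.norm_scale max_mult_distrib_left)
  next
    fix X :: "nat \<Rightarrow> 'a \<times> 'b" assume X: "\<And>n. X n \<in> carr A \<times> carr B"
      and C: "\<And>e::real. e > 0 \<Longrightarrow> \<exists>N. \<forall>m\<ge>N. \<forall>n\<ge>N.
          max (adist A (fst (X m)) (fst (X n))) (adist B (snd (X m)) (snd (X n))) < e"
    have m: "fst (X n) \<in> carr A" "snd (X n) \<in> carr B" for n using X[of n] by auto
    obtain L where L: "L \<in> carr A" "(\<lambda>n. adist A (fst (X n)) L) \<longlonglongrightarrow> 0"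
      using A.complete[of "\<lambda>n. fst (X n)"] m C by (metis max_less_iff_conj)
    obtain M where M: "M \<in> carr B" "(\<lambda>n. adist B (snd (X n)) M) \<longlonglongrightarrow> 0"
      using B.complete[of "\<lambda>n. snd (X n)"] m C by (metis max_less_iff_conj)
    have "(\<lambda>n. max (adist A (fst (X n)) L) (adist B (snd (X n)) M)) \<longlonglongrightarrow> max 0 0"
      by (intro tendsto_max L M)
    then show "\<exists>L\<in>carr A \<times> carr B. (\<lambda>n. max (adist A (fst (X n)) (fst L)) (adist B (snd (X n)) (snd L))) \<longlonglongrightarrow> 0"
      using L M by (intro bexI[of _ "(L, M)"]) auto
  qed (auto simp: A.zero_closed A.add_closed A.scale_closed A.mult_closed A.star_closed A.add_assoc A.add_zero A.scale_one A.scale_zero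
      A.scale_scale A.scale_add_right A.scale_add_left A.mult_assoc A.mult_add_left
      A.mult_add_right A.mult_scale_left A.mult_scale_right A.star_star A.star_add A.star_scale
      A.star_mult A.norm_nonneg le_max_iff_disj
      B.zero_closed B.add_closed B.scale_closed B.mult_closed B.star_closed B.add_assoc B.add_zero B.scale_one B.scale_zero
      B.scale_scale B.scale_add_right B.scale_add_left B.mult_assoc B.mult_add_left
      B.mult_add_right B.mult_scale_left B.mult_scale_right B.star_star B.star_add B.star_scale
      B.star_mult B.norm_nonneg intro: A.add_commute B.add_commute)
qed


definition linear_map :: "'a star_algebra \<Rightarrow> 'b star_algebra \<Rightarrow> ('a \<Rightarrow> 'b) \<Rightarrow> bool" where
  "linear_map A B \<phi> \<longleftrightarrow>
     \<phi> ` carr A \<subseteq> carr B \<and>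
     (\<forall>x\<in>carr A. \<forall>y\<in>carr A. \<phi> (aadd A x y) = aadd B (\<phi> x) (\<phi> y)) \<and>
     (\<forall>c. \<forall>x\<in>carr A. \<phi> (ascale A c x) = ascale B c (\<phi> x))"

definition star_hom :: "'a star_algebra \<Rightarrow> 'b star_algebra \<Rightarrow> ('a \<Rightarrow> 'b) \<Rightarrow> bool" where
  "star_hom A B \<phi> \<longleftrightarrow>
     linear_map A B \<phi> \<and>
     (\<forall>x\<in>carr A. \<forall>y\<in>carr A. \<phi> (amult A x y) = amult B (\<phi> x) (\<phi> y)) \<and>
     (\<forall>x\<in>carr A. \<phi> (astar A x) = astar B (\<phi> x))"

definition rota_baxter :: "complex \<Rightarrow> 'a star_algebra \<Rightarrow> ('a \<Rightarrow> 'a) \<Rightarrow> bool" where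
  "rota_baxter w A P \<longleftrightarrow>
     cstar_algebra A \<and> linear_map A A P \<and>
     (\<forall>a\<in>carr A. \<forall>b\<in>carr A.
        amult A (P a) (P b) =
        aadd A (aadd A (P (amult A a (P b))) (P (amult A (P a) b))) (ascale A w (P (amult A a b))))"

definition rota_baxter_hom ::
  "'a star_algebra \<Rightarrow> ('a \<Rightarrow> 'a) \<Rightarrow> 'b star_algebra \<Rightarrow> ('b \<Rightarrow> 'b) \<Rightarrow> ('a \<Rightarrow> 'b) \<Rightarrow> bool" where
  "rota_baxter_hom A P B Q \<phi> \<longleftrightarrow> star_hom A B \<phi> \<and> (\<forall>a\<in>carr A. \<phi> (P a) = Q (\<phi> a))"

text \<open>\<open>rota_baxter_star_rep w A P Q \<pi> f\<close>: \<open>{\<pi>, K, f}\<close> is a Rota-Baxter *-representation of \<open>(A, P)\<close>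
  into \<open>(B(K), Q)\<close>, where the Hilbert space \<open>K\<close> is the type \<open>'k\<close>. The operator \<open>f\<close> is linear but
  not required to be bounded; \<open>w\<close> is the weight.\<close>

definition rota_baxter_star_rep ::
  "complex \<Rightarrow> 'a star_algebra \<Rightarrow> ('a \<Rightarrow> 'a) \<Rightarrow> (('k::complex_hilbert \<Rightarrow> 'k) \<Rightarrow> ('k \<Rightarrow> 'k)) \<Rightarrow>
    ('a \<Rightarrow> ('k \<Rightarrow> 'k)) \<Rightarrow> ('k \<Rightarrow> 'k) \<Rightarrow> bool" where
  "rota_baxter_star_rep w A P Q \<pi> f \<longleftrightarrow>
     rota_baxter w A P \<and> rota_baxter w \<B> Q \<and> rota_baxter_hom A P \<B> Q \<pi> \<and> clinear f \<and>
     (\<forall>b\<in>\<pi> ` carr A. \<forall>h. Q b (f h) = f (Q b h) + f (b (f h)) + w *\<^sub>C f (b h))"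


definition block_op ::
  "('a \<Rightarrow> 'a) \<Rightarrow> ('b \<Rightarrow> 'a) \<Rightarrow> ('a \<Rightarrow> 'b) \<Rightarrow> ('b \<Rightarrow> 'b) \<Rightarrow>
    ('a::complex_hilbert \<times> 'b::complex_hilbert \<Rightarrow> 'a \<times> 'b)" where
  "block_op a11 a12 a21 a22 = (\<lambda>(x, y). (a11 x + a12 y, a21 x + a22 y))"

definition entry11 :: "('a::complex_hilbert \<times> 'b::complex_hilbert \<Rightarrow> 'a \<times> 'b) \<Rightarrow> ('a \<Rightarrow> 'a)" where
  "entry11 T = (\<lambda>x. fst (T (x, 0)))"

definition entry12 :: "('a::complex_hilbert \<times> 'b::complex_hilbert \<Rightarrow> 'a \<times> 'b) \<Rightarrow> ('b \<Rightarrow> 'a)" where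
  "entry12 T = (\<lambda>y. fst (T (0, y)))"

definition entry21 :: "('a::complex_hilbert \<times> 'b::complex_hilbert \<Rightarrow> 'a \<times> 'b) \<Rightarrow> ('a \<Rightarrow> 'b)" where
  "entry21 T = (\<lambda>x. snd (T (x, 0)))"

definition entry22 :: "('a::complex_hilbert \<times> 'b::complex_hilbert \<Rightarrow> 'a \<times> 'b) \<Rightarrow> ('b \<Rightarrow> 'b)" where
  "entry22 T = (\<lambda>y. snd (T (0, y)))"

lemma block_op_entries:
  assumes "clinear T"
  shows "block_op (entry11 T) (entry12 T) (entry21 T) (entry22 T) = T"
proof
  fix z :: "'a \<times> 'b"
  obtain x y where z: "z = (x, y)" by (cases z)
  have "T (x, y) = T ((x, 0) + (0, y))" by simp
  also have "\<dots> = T (x, 0) + T (0, y)" using assms unfolding clinear_def by blast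
  finally show "block_op (entry11 T) (entry12 T) (entry21 T) (entry22 T) z = T z"
    by (simp add: z block_op_def entry11_def entry12_def entry21_def entry22_def prod_eq_iff)
qed

text \<open>\<open>B(H\<^sub>1)\<close> and \<open>B(H\<^sub>2)\<close> as the diagonal corners of \<open>B(H\<^sub>1 \<oplus> H\<^sub>2)\<close>.\<close>

definition corner1 :: "('a::complex_hilbert \<times> 'b::complex_hilbert \<Rightarrow> 'a \<times> 'b) set" where
  "corner1 = {block_op a (\<lambda>_. 0) (\<lambda>_. 0) (\<lambda>_. 0) | a. a \<in> carr \<B>}"

definition corner2 :: "('a::complex_hilbert \<times> 'b::complex_hilbert \<Rightarrow> 'a \<times> 'b) set" where
  "corner2 = {block_op (\<lambda>_. 0) (\<lambda>_. 0) (\<lambda>_. 0) a | a. a \<in> carr \<B>}"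

definition proj1 :: "'a::complex_hilbert \<times> 'b::complex_hilbert \<Rightarrow> 'a \<times> 'b" where
  "proj1 = (\<lambda>(x, y). (x, 0))"

definition block_rota_baxter ::
  "(('a::complex_hilbert \<Rightarrow> 'a) \<Rightarrow> ('a \<Rightarrow> 'a)) \<Rightarrow> (('b::complex_hilbert \<Rightarrow> 'b) \<Rightarrow> ('b \<Rightarrow> 'b)) \<Rightarrow>
    ('a \<times> 'b \<Rightarrow> 'a \<times> 'b) \<Rightarrow> ('a \<times> 'b \<Rightarrow> 'a \<times> 'b)" where
  "block_rota_baxter P1' P2' T =
     block_op (P1' (entry11 T)) (entry12 T) (\<lambda>_. 0) (P2' (entry22 T))"

end

theory Submission
  imports Defs
begin

text \<open>
Write \<open>P'\<close> for the operator on block matrices. The proof rests on the block diagonal embedding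
\<open>\<Delta> (a, d) = diag(a, d)\<close>. It is an injective \<open>*\<close>-homomorphism from \<open>B(H\<^sub>1) \<oplus> B(H\<^sub>2)\<close> into
\<open>B(H\<^sub>1 \<oplus> H\<^sub>2)\<close>, and \<open>P' (\<Delta> (a, d)) = \<Delta> (P1' a, P2' d)\<close>, so it is a Rota-Baxter homomorphism
(\<open>rota_baxter_hom_block_diagonal\<close>). Representations \<open>\<pi>1\<close> and \<open>\<pi>2\<close> therefore combine to
\<open>\<pi> = \<Delta> \<circ> (\<pi>1 \<times> \<pi>2)\<close>. Conversely, if \<open>\<pi>\<close> maps each summand into its corner, composing it with the
inclusion of the summand gives a Rota-Baxter homomorphism into that corner, and since the
embedding of \<open>B(H\<^sub>i)\<close> onto its corner is injective and itself a Rota-Baxter homomorphism, it can be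
cancelled (\<open>rota_baxter_hom_lift\<close>).

The matching conditions hold because the weight is \<open>-1\<close>: for an idempotent \<open>f\<close> that
commutes with the image of the representation they reduce to \<open>f b - f b = 0\<close>
(\<open>rota_baxter_star_repI_idempotent\<close>). The identity commutes with everything, and \<open>proj1\<close> with
every block diagonal operator.

It remains to see that \<open>P'\<close> is a Rota-Baxter operator on all of \<open>B(H\<^sub>1 \<oplus> H\<^sub>2)\<close>, not only on the
diagonal part (\<open>rota_baxter_block_rota_baxter\<close>). This is a computation with the four matrix entries.
\<close>


section \<open>Rota-Baxter homomorphisms\<close>

lemma linear_map_zero:
  assumes "cstar_algebra A" "cstar_algebra B" "linear_map A B \<phi>"
  shows "\<phi> (azero A) = azero B"
proof -
  interpret A: cstar_algebra A by fact
  interpret B: cstar_algebra B by fact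
  have "\<phi> (azero A) \<in> carr B"
    using assms(3) A.zero_closed by (auto simp: linear_map_def)
  moreover have "\<phi> (ascale A 0 (azero A)) = ascale B 0 (\<phi> (azero A))"
    using assms(3) A.zero_closed by (simp add: linear_map_def)
  ultimately show ?thesis
    by (simp add: A.scale_zero[OF A.zero_closed] B.scale_zero)
qed

lemma rota_baxter_hom_compose:
  assumes "rota_baxter_hom A P B Q \<phi>" "rota_baxter_hom B Q C R \<psi>"
  shows "rota_baxter_hom A P C R (\<psi> \<circ> \<phi>)"
  using assms by (auto simp: rota_baxter_hom_def star_hom_def linear_map_def image_subset_iff)

lemma rota_baxter_hom_map_prod:
  assumes "rota_baxter_hom A P C R \<phi>" "rota_baxter_hom B Q D S \<psi>"
  shows "rota_baxter_hom (A \<oplus>\<^sub>* B) (map_prod P Q) (C \<oplus>\<^sub>* D) (map_prod R S) (map_prod \<phi> \<psi>)"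
  using assms
  by (auto simp: rota_baxter_hom_def star_hom_def linear_map_def image_subset_iff direct_sum_def)

lemma rota_baxter_direct_sum:
  assumes "rota_baxter w A P" "rota_baxter w B Q"
  shows "rota_baxter w (A \<oplus>\<^sub>* B) (map_prod P Q)"
proof -
  have "cstar_algebra (A \<oplus>\<^sub>* B)"
    using assms by (intro cstar_algebra_direct_sum) (simp_all add: rota_baxter_def)
  then show ?thesis
    using assms by (auto simp: rota_baxter_def linear_map_def image_subset_iff direct_sum_def)
qed

lemma cstar_algebra_zero_ops:
  assumes "cstar_algebra A"
  shows "azero A \<in> carr A" "aadd A (azero A) (azero A) = azero A"
    "ascale A c (azero A) = azero A" "amult A (azero A) (azero A) = azero A"
    "astar A (azero A) = azero A"
proof -
  interpret cstar_algebra A by fact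
  have z: "azero A = ascale A 0 (azero A)" using scale_zero[OF zero_closed] by simp
  show "azero A \<in> carr A" by (rule zero_closed)
  show "aadd A (azero A) (azero A) = azero A" by (rule add_zero[OF zero_closed])
  show "ascale A c (azero A) = azero A"
    by (metis z mult_zero_right scale_scale zero_closed)
  show "amult A (azero A) (azero A) = azero A"
    by (metis z mult_closed mult_scale_left scale_zero zero_closed)
  show "astar A (azero A) = azero A"
    by (metis z star_scale complex_cnj_zero scale_zero star_closed zero_closed)
qed

lemma rota_baxter_hom_inclusions:
  assumes "rota_baxter w A P" "rota_baxter w B Q"
  shows "rota_baxter_hom A P (A \<oplus>\<^sub>* B) (map_prod P Q) (\<lambda>a. (a, azero B))"
    and "rota_baxter_hom B Q (A \<oplus>\<^sub>* B) (map_prod P Q) (\<lambda>b. (azero A, b))"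
proof -
  have A: "cstar_algebra A" "P (azero A) = azero A" and B: "cstar_algebra B" "Q (azero B) = azero B"
    using assms linear_map_zero by (auto simp: rota_baxter_def)
  show "rota_baxter_hom A P (A \<oplus>\<^sub>* B) (map_prod P Q) (\<lambda>a. (a, azero B))"
    and "rota_baxter_hom B Q (A \<oplus>\<^sub>* B) (map_prod P Q) (\<lambda>b. (azero A, b))"
    by (auto simp: rota_baxter_hom_def star_hom_def linear_map_def direct_sum_def A B
        cstar_algebra_zero_ops[OF A(1)] cstar_algebra_zero_ops[OF B(1)])
qed

text \<open>Because \<open>\<delta>\<close> is injective and both maps preserve every operation, an identity for the lift
  follows from the same identity for \<open>\<phi>\<close> after applying \<open>\<delta>\<close>. With \<open>\<delta>\<close> the embedding of a corner,
  this turns a homomorphism into that corner of \<open>B(H\<^sub>1 \<oplus> H\<^sub>2)\<close> into one into \<open>B(H\<^sub>i)\<close>.\<close>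

lemma rota_baxter_hom_lift:
  assumes \<phi>: "rota_baxter_hom A P B Q \<phi>" and \<delta>: "rota_baxter_hom C R B Q \<delta>"
    and inj: "inj_on \<delta> (carr C)" and sub: "\<phi> ` carr A \<subseteq> \<delta> ` carr C"
    and A: "rota_baxter w A P" and C: "rota_baxter w C R"
  shows "\<exists>\<psi>. rota_baxter_hom A P C R \<psi>"
proof -
  interpret A: cstar_algebra A using A by (simp add: rota_baxter_def)
  interpret C: cstar_algebra C using C by (simp add: rota_baxter_def)
  have P: "P a \<in> carr A" if "a \<in> carr A" for a
    using A that by (auto simp: rota_baxter_def linear_map_def)
  have R: "R c \<in> carr C" if "c \<in> carr C" for c
    using C that by (auto simp: rota_baxter_def linear_map_def)
  have "\<forall>a\<in>carr A. \<exists>c. c \<in> carr C \<and> \<delta> c = \<phi> a" using sub by force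
  then obtain \<psi> where \<psi>: "\<And>a. a \<in> carr A \<Longrightarrow> \<psi> a \<in> carr C" "\<And>a. a \<in> carr A \<Longrightarrow> \<delta> (\<psi> a) = \<phi> a"
    by metis
  have eq: "\<psi> a = c" if "a \<in> carr A" "c \<in> carr C" "\<phi> a = \<delta> c" for a c
    using inj_onD[OF inj] that \<psi> by metis
  have "rota_baxter_hom A P C R \<psi>"
    unfolding rota_baxter_hom_def star_hom_def linear_map_def
  proof (intro conjI ballI allI)
    fix a b c assume a: "a \<in> carr A" and b: "b \<in> carr A"
    show "\<psi> (aadd A a b) = aadd C (\<psi> a) (\<psi> b)" "\<psi> (amult A a b) = amult C (\<psi> a) (\<psi> b)"
      "\<psi> (ascale A c a) = ascale C c (\<psi> a)" "\<psi> (astar A a) = astar C (\<psi> a)" "\<psi> (P a) = R (\<psi> a)"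
      using a b \<phi> \<delta> \<psi>
      by (auto intro!: eq A.add_closed A.mult_closed A.scale_closed A.star_closed P R
          C.add_closed C.mult_closed C.scale_closed C.star_closed
          simp: rota_baxter_hom_def star_hom_def linear_map_def)
  qed (use \<psi> in auto)
  then show ?thesis by blast
qed


section \<open>Block operators on a direct sum of Hilbert spaces\<close>

lemma scaleC_Pair: "c *\<^sub>C (x, y) = (c *\<^sub>C x, c *\<^sub>C y)"
  by (simp add: scaleC_prod_def)

lemma clinear_zero: "clinear T \<Longrightarrow> T 0 = 0"
  unfolding clinear_def by (metis scaleC_zero_left)

lemma bounded_clinear_zero: "bounded_clinear (\<lambda>_. 0)"
  by (auto simp: bounded_clinear_iff)

lemma bounded_clinear_add:
  "bounded_clinear S \<Longrightarrow> bounded_clinear T \<Longrightarrow> bounded_clinear (\<lambda>x. S x + T x)"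
  by (auto simp: bounded_clinear_iff bounded_linear_add scaleC_add_right)

lemma bounded_clinear_compose:
  "bounded_clinear S \<Longrightarrow> bounded_clinear T \<Longrightarrow> bounded_clinear (\<lambda>x. S (T x))"
  by (auto simp: bounded_clinear_iff intro: bounded_linear_compose)

lemma bounded_clinear_scaleC:
  assumes "bounded_clinear T"
  shows "bounded_clinear (\<lambda>x. k *\<^sub>C T x)"
proof -
  have "bounded_linear (\<lambda>x::'b. k *\<^sub>C x)"
    by (rule bounded_linear_intro[where K = "cmod k"])
      (auto simp: scaleC_add_right scaleR_scaleC scaleC_scaleC norm_scaleC mult.commute)
  then show ?thesis
    using assms by (auto simp: bounded_clinear_iff scaleC_scaleC mult.commute
        intro: bounded_linear_compose)
qed

lemma bounded_clinear_block_op: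
  assumes "bounded_clinear a" "bounded_clinear b" "bounded_clinear c" "bounded_clinear d"
  shows "bounded_clinear (block_op a b c d)"
proof -
  have "bounded_linear (\<lambda>z. (a (fst z) + b (snd z), c (fst z) + d (snd z)))"
    using assms unfolding bounded_clinear_iff
    by (intro bounded_linear_Pair bounded_linear_add bounded_linear_compose[OF _ bounded_linear_fst]
        bounded_linear_compose[OF _ bounded_linear_snd]) auto
  then show ?thesis
    using assms by (auto simp: bounded_clinear_iff block_op_def case_prod_unfold scaleC_prod_def
        scaleC_add_right)
qed

lemma bounded_clinear_entries:
  assumes "bounded_clinear T"
  shows "bounded_clinear (entry11 T)" "bounded_clinear (entry12 T)"
    "bounded_clinear (entry21 T)" "bounded_clinear (entry22 T)"
proof -
  have T: "bounded_linear T" and sc: "\<And>c z. T (c *\<^sub>C z) = c *\<^sub>C T z"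
    using assms by (auto simp: bounded_clinear_iff)
  have i: "bounded_linear (\<lambda>x. T (x, 0))" "bounded_linear (\<lambda>y. T (0, y))"
    by (intro bounded_linear_compose[OF T] bounded_linear_Pair bounded_linear_ident
        bounded_linear_zero)+
  have s: "T (c *\<^sub>C x, 0) = c *\<^sub>C T (x, 0)" "T (0, c *\<^sub>C y) = c *\<^sub>C T (0, y)" for c x y
    using sc[of c "(x, 0)"] sc[of c "(0, y)"] by (simp_all add: scaleC_Pair)
  show "bounded_clinear (entry11 T)" "bounded_clinear (entry12 T)"
    "bounded_clinear (entry21 T)" "bounded_clinear (entry22 T)"
    using i by (auto simp: bounded_clinear_iff entry11_def entry12_def entry21_def entry22_def s
        scaleC_prod_def
        intro: bounded_linear_compose[OF bounded_linear_fst] bounded_linear_compose[OF bounded_linear_snd])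
qed

lemma bounded_clinear_cases_block_op:
  assumes "bounded_clinear T"
  obtains a b c d where "T = block_op a b c d"
    "bounded_clinear a" "bounded_clinear b" "bounded_clinear c" "bounded_clinear d"
  using block_op_entries[of T] bounded_clinear_entries[OF assms] assms
  by (metis bounded_clinear_def)

lemma block_op_compose:
  assumes "clinear a" "clinear b" "clinear c" "clinear d"
  shows "block_op a b c d \<circ> block_op a' b' c' d' =
    block_op (\<lambda>x. a (a' x) + b (c' x)) (\<lambda>y. a (b' y) + b (d' y))
      (\<lambda>x. c (a' x) + d (c' x)) (\<lambda>y. c (b' y) + d (d' y))"
  using assms by (auto simp: fun_eq_iff block_op_def clinear_def algebra_simps)

lemma block_op_add:
  "(\<lambda>z. block_op a b c d z + block_op a' b' c' d' z) =
    block_op (\<lambda>x. a x + a' x) (\<lambda>y. b y + b' y) (\<lambda>x. c x + c' x) (\<lambda>y. d y + d' y)"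
  by (auto simp: fun_eq_iff block_op_def algebra_simps)

lemma block_op_scaleC:
  "(\<lambda>z. k *\<^sub>C block_op a b c d z) =
    block_op (\<lambda>x. k *\<^sub>C a x) (\<lambda>y. k *\<^sub>C b y) (\<lambda>x. k *\<^sub>C c x) (\<lambda>y. k *\<^sub>C d y)"
  by (auto simp: fun_eq_iff block_op_def scaleC_Pair scaleC_add_right)

lemma adjoint_op_block_diagonal:
  assumes "bounded_clinear a" "bounded_clinear d"
  shows "adjoint_op (block_op a (\<lambda>_. 0) (\<lambda>_. 0) d) =
    block_op (adjoint_op a) (\<lambda>_. 0) (\<lambda>_. 0) (adjoint_op d)"
  using assms
  by (intro adjoint_op_unique bounded_clinear_block_op bounded_clinear_zero bounded_clinear_adjoint_op)
    (auto simp: block_op_def cinner_prod_def cinner_adjoint_op)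


section \<open>The Rota-Baxter operator on block matrices\<close>

lemma bounded_operators_simps:
  "T \<in> carr \<B> \<longleftrightarrow> bounded_clinear T" "azero \<B> = (\<lambda>_. 0)"
  "aadd \<B> S T = (\<lambda>x. S x + T x)" "ascale \<B> k T = (\<lambda>x. k *\<^sub>C T x)" "amult \<B> S T = S \<circ> T"
  "astar \<B> = adjoint_op"
  by (simp_all add: bounded_operators_def)

lemma block_rota_baxter_block_op:
  assumes "bounded_clinear a" "bounded_clinear b" "bounded_clinear c" "bounded_clinear d"
  shows "block_rota_baxter P1' P2' (block_op a b c d) = block_op (P1' a) b (\<lambda>_. 0) (P2' d)"
  using assms clinear_zero[of a] clinear_zero[of b] clinear_zero[of c] clinear_zero[of d]
  by (simp add: block_rota_baxter_def block_op_def entry11_def entry12_def entry22_def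
      bounded_clinear_def)

text \<open>The weight \<open>-1\<close> is what makes this true. In \<open>P'(S P'(T)) + P'(P'(S) T) - P'(S T)\<close> the
  products of off-diagonal entries that enter a diagonal position come once with each sign and
  cancel; on the \<open>(1,2)\<close> entry \<open>P'\<close> acts as the identity and the terms free of \<open>P1'\<close> and \<open>P2'\<close>
  cancel as well.\<close>

lemma rota_baxter_block_rota_baxter:
  fixes P1' :: "('a::complex_hilbert \<Rightarrow> 'a) \<Rightarrow> ('a \<Rightarrow> 'a)"
    and P2' :: "('b::complex_hilbert \<Rightarrow> 'b) \<Rightarrow> ('b \<Rightarrow> 'b)"
  assumes P1': "rota_baxter (-1) \<B> P1'" and P2': "rota_baxter (-1) \<B> P2'"
  shows "rota_baxter (-1) \<B> (block_rota_baxter P1' P2')"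
proof -
  let ?P' = "block_rota_baxter P1' P2' :: ('a \<times> 'b \<Rightarrow> 'a \<times> 'b) \<Rightarrow> _"
  note bc = bounded_clinear_zero bounded_clinear_add bounded_clinear_compose
    bounded_clinear_scaleC bounded_clinear_block_op
  have lin1: "linear_map \<B> \<B> P1'" and lin2: "linear_map \<B> \<B> P2'"
    using P1' P2' by (simp_all add: rota_baxter_def)
  note P = lin1[unfolded linear_map_def image_subset_iff] lin2[unfolded linear_map_def image_subset_iff]
  have cl: "bounded_clinear a \<Longrightarrow> bounded_clinear (P1' a)" "bounded_clinear d \<Longrightarrow> bounded_clinear (P2' d)"
    for a d
    using P by (simp_all add: bounded_operators_simps)
  have add: "P1' (\<lambda>x. a x + a' x) = (\<lambda>x. P1' a x + P1' a' x)"
    if "bounded_clinear a" "bounded_clinear a'" for a a'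
    using P that by (simp add: bounded_operators_simps)
  have add': "P2' (\<lambda>x. a x + a' x) = (\<lambda>x. P2' a x + P2' a' x)"
    if "bounded_clinear a" "bounded_clinear a'" for a a'
    using P that by (simp add: bounded_operators_simps)
  have scale: "P1' (\<lambda>x. k *\<^sub>C a x) = (\<lambda>x. k *\<^sub>C P1' a x)"
    if "bounded_clinear a" for a k
    using P that by (simp add: bounded_operators_simps)
  have scale': "P2' (\<lambda>x. k *\<^sub>C a x) = (\<lambda>x. k *\<^sub>C P2' a x)"
    if "bounded_clinear a" for a k
    using P that by (simp add: bounded_operators_simps)
  have rb: "P1' a (P1' a' x) = P1' (\<lambda>x. a (P1' a' x)) x + P1' (\<lambda>x. P1' a (a' x)) x - P1' (\<lambda>x. a (a' x)) x"
    if "bounded_clinear a" "bounded_clinear a'" for a a' x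
    using P1' that by (simp add: rota_baxter_def bounded_operators_simps scaleC_minus_one o_def
        fun_eq_iff)
  have rb': "P2' a (P2' a' x) = P2' (\<lambda>x. a (P2' a' x)) x + P2' (\<lambda>x. P2' a (a' x)) x - P2' (\<lambda>x. a (a' x)) x"
    if "bounded_clinear a" "bounded_clinear a'" for a a' x
    using P2' that by (simp add: rota_baxter_def bounded_operators_simps scaleC_minus_one o_def
        fun_eq_iff)
  show ?thesis
    unfolding rota_baxter_def linear_map_def bounded_operators_simps image_subset_iff Ball_def
  proof (intro conjI allI impI cstar_algebra_bounded_operators)
    fix S T :: "'a \<times> 'b \<Rightarrow> 'a \<times> 'b" and k
    assume "bounded_clinear S" "bounded_clinear T"
    then obtain a b c d a' b' c' d'
      where S: "S = block_op a b c d" and T: "T = block_op a' b' c' d'"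
        and bcS: "bounded_clinear a" "bounded_clinear b" "bounded_clinear c" "bounded_clinear d"
        and bcT: "bounded_clinear a'" "bounded_clinear b'" "bounded_clinear c'" "bounded_clinear d'"
      by (metis bounded_clinear_cases_block_op)
    have cli: "clinear a" "clinear b" "clinear c" "clinear d" "clinear (P1' a)" "clinear (P2' d)"
      "clinear (\<lambda>_::'a. 0::'b)" "b 0 = 0" "P1' a 0 = 0" "d 0 = 0" "P2' d 0 = 0"
      using bcS cl(1)[of a] cl(2)[of d] clinear_zero by (auto simp: bounded_clinear_def clinear_def)
    show "bounded_clinear (?P' S)"
      by (simp add: S block_rota_baxter_block_op bcS bc cl)
    show "?P' (\<lambda>x. S x + T x) = (\<lambda>x. ?P' S x + ?P' T x)"
      by (simp add: S T block_op_add block_rota_baxter_block_op bcS bcT bc cl add add')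
    show "?P' (\<lambda>x. k *\<^sub>C S x) = (\<lambda>x. k *\<^sub>C ?P' S x)"
      by (simp add: S block_op_scaleC block_rota_baxter_block_op bcS bc scale scale')
    show "?P' S \<circ> ?P' T =
      (\<lambda>x. ?P' (S \<circ> ?P' T) x + ?P' (?P' S \<circ> T) x + (-1) *\<^sub>C ?P' (S \<circ> T) x)"
      by (simp add: S T block_op_add block_op_scaleC block_op_compose block_rota_baxter_block_op
          bcS bcT bc cl cli add add')
        (simp add: block_op_def fun_eq_iff rb rb' bcS bcT scaleC_minus_one)
  qed
qed


section \<open>The block diagonal embedding\<close>

definition block_diagonal ::
  "('a::complex_hilbert \<Rightarrow> 'a) \<times> ('b::complex_hilbert \<Rightarrow> 'b) \<Rightarrow> ('a \<times> 'b \<Rightarrow> 'a \<times> 'b)" where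
  "block_diagonal = (\<lambda>(a, d). block_op a (\<lambda>_. 0) (\<lambda>_. 0) d)"

lemma entries_block_diagonal:
  assumes "bounded_clinear a" "bounded_clinear d"
  shows "entry11 (block_diagonal (a, d)) = a" "entry22 (block_diagonal (a, d)) = d"
  using assms by (simp_all add: block_diagonal_def block_op_def entry11_def entry22_def)

text \<open>On block diagonal matrices \<open>P'\<close> acts as \<open>P1' \<oplus> P2'\<close>, so they form a copy of
  \<open>(B(H\<^sub>1) \<oplus> B(H\<^sub>2), P1' \<oplus> P2')\<close> inside \<open>(B(H\<^sub>1 \<oplus> H\<^sub>2), P')\<close>.\<close>

lemma rota_baxter_hom_block_diagonal:
  fixes P1' :: "('a::complex_hilbert \<Rightarrow> 'a) \<Rightarrow> ('a \<Rightarrow> 'a)"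
    and P2' :: "('b::complex_hilbert \<Rightarrow> 'b) \<Rightarrow> ('b \<Rightarrow> 'b)"
  shows "rota_baxter_hom (\<B> \<oplus>\<^sub>* \<B>) (map_prod P1' P2') \<B> (block_rota_baxter P1' P2') block_diagonal"
  unfolding rota_baxter_hom_def star_hom_def linear_map_def image_subset_iff
proof (intro conjI ballI allI)
  fix x y k
  assume "x \<in> carr (\<B> \<oplus>\<^sub>* \<B> :: (('a \<Rightarrow> 'a) \<times> ('b \<Rightarrow> 'b)) star_algebra)"
    and "y \<in> carr (\<B> \<oplus>\<^sub>* \<B> :: (('a \<Rightarrow> 'a) \<times> ('b \<Rightarrow> 'b)) star_algebra)"
  then obtain a d a' d' where xy: "x = (a, d)" "y = (a', d')"
    and bc: "bounded_clinear a" "bounded_clinear d"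
    by (auto simp: direct_sum_def bounded_operators_simps)
  have cli: "clinear a" "clinear d" "clinear (\<lambda>_::'a. 0::'b)" "clinear (\<lambda>_::'b. 0::'a)" "a 0 = 0" "d 0 = 0"
    using bc clinear_zero by (auto simp: bounded_clinear_def clinear_def)
  show "block_diagonal x \<in> carr \<B>"
    by (simp add: xy block_diagonal_def bounded_operators_simps bounded_clinear_block_op
        bounded_clinear_zero bc)
  show "block_diagonal (amult (\<B> \<oplus>\<^sub>* \<B>) x y) = amult \<B> (block_diagonal x) (block_diagonal y)"
    by (simp add: xy block_diagonal_def direct_sum_def bounded_operators_simps block_op_compose cli)
      (simp add: o_def)
  show "block_diagonal (aadd (\<B> \<oplus>\<^sub>* \<B>) x y) = aadd \<B> (block_diagonal x) (block_diagonal y)"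
    "block_diagonal (ascale (\<B> \<oplus>\<^sub>* \<B>) k x) = ascale \<B> k (block_diagonal x)"
    "block_diagonal (astar (\<B> \<oplus>\<^sub>* \<B>) x) = astar \<B> (block_diagonal x)"
    "block_diagonal (map_prod P1' P2' x) = block_rota_baxter P1' P2' (block_diagonal x)"
    by (simp_all add: xy block_diagonal_def direct_sum_def bounded_operators_simps block_op_add
        block_op_scaleC adjoint_op_block_diagonal block_rota_baxter_block_op
        bounded_clinear_zero bc)
qed

lemma corner1_eq_image: "corner1 = (\<lambda>a. block_diagonal (a, azero \<B>)) ` carr \<B>"
  by (auto simp: corner1_def block_diagonal_def bounded_operators_simps)

lemma corner2_eq_image: "corner2 = (\<lambda>d. block_diagonal (azero \<B>, d)) ` carr \<B>"
  by (auto simp: corner2_def block_diagonal_def bounded_operators_simps)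

lemma rota_baxter_hom_corner_embeddings:
  assumes "rota_baxter w \<B> P1'" "rota_baxter w \<B> P2'"
  shows "rota_baxter_hom \<B> P1' \<B> (block_rota_baxter P1' P2') (\<lambda>a. block_diagonal (a, azero \<B>))"
    and "rota_baxter_hom \<B> P2' \<B> (block_rota_baxter P1' P2') (\<lambda>d. block_diagonal (azero \<B>, d))"
  using rota_baxter_hom_inclusions[OF assms, THEN rota_baxter_hom_compose,
      OF rota_baxter_hom_block_diagonal]
  by (simp_all add: o_def)

lemma inj_on_corner_embeddings:
  "inj_on (\<lambda>a. block_diagonal (a, azero \<B>)) (carr \<B>)"
  "inj_on (\<lambda>d. block_diagonal (azero \<B>, d)) (carr \<B>)"
  by (rule inj_on_inverseI[where g = entry11],
      simp add: bounded_operators_simps entries_block_diagonal bounded_clinear_zero,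
      rule inj_on_inverseI[where g = entry22],
      simp add: bounded_operators_simps entries_block_diagonal bounded_clinear_zero)


section \<open>The matching conditions\<close>

text \<open>At weight \<open>-1\<close> the matching condition for an idempotent \<open>f\<close> holds on every \<open>b\<close> for
  which \<open>b\<close> and \<open>Q b\<close> commute with \<open>f\<close>: then \<open>f b f = f f b = f b\<close>, so the last two terms cancel.
  It suffices that the image of \<open>\<pi>\<close> commutes with \<open>f\<close>, because \<open>Q (\<pi> a) = \<pi> (P a)\<close> lies in that
  image. This covers the identity, and \<open>proj1\<close> when the image is block diagonal.\<close>

lemma rota_baxter_star_repI_idempotent:
  assumes "rota_baxter (-1) A P" "rota_baxter (-1) \<B> Q" "rota_baxter_hom A P \<B> Q \<pi>"
    and "clinear f" "\<And>h. f (f h) = f h"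
    and comm: "\<And>a h. a \<in> carr A \<Longrightarrow> \<pi> a (f h) = f (\<pi> a h)"
  shows "rota_baxter_star_rep (-1) A P Q \<pi> f"
proof -
  have "Q (\<pi> a) (f h) = f (Q (\<pi> a) h) + f (\<pi> a (f h)) + (-1) *\<^sub>C f (\<pi> a h)"
    if a: "a \<in> carr A" for a h
  proof -
    have "P a \<in> carr A" and "\<pi> (P a) = Q (\<pi> a)"
      using a assms(1,3) by (auto simp: rota_baxter_def linear_map_def rota_baxter_hom_def)
    then show ?thesis
      using comm[of "P a" h] comm[OF a, of h] assms(5) by (simp add: scaleC_minus_one)
  qed
  then show ?thesis
    using assms by (auto simp: rota_baxter_star_rep_def)
qed

lemma block_diagonal_proj1:
  assumes "bounded_clinear a" "bounded_clinear d"
  shows "block_diagonal (a, d) (proj1 h) = proj1 (block_diagonal (a, d) h)"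
  using assms clinear_zero[of d]
  by (cases h) (simp add: block_diagonal_def block_op_def proj1_def bounded_clinear_def)


theorem theorem3p16:
  fixes P1' :: "('h1::complex_hilbert \<Rightarrow> 'h1) \<Rightarrow> ('h1 \<Rightarrow> 'h1)"
    and P2' :: "('h2::complex_hilbert \<Rightarrow> 'h2) \<Rightarrow> ('h2 \<Rightarrow> 'h2)"
    and A1 :: "('h1 \<Rightarrow> 'h1) star_algebra" and A2 :: "('h2 \<Rightarrow> 'h2) star_algebra"
    and P1 :: "('h1 \<Rightarrow> 'h1) \<Rightarrow> ('h1 \<Rightarrow> 'h1)" and P2 :: "('h2 \<Rightarrow> 'h2) \<Rightarrow> ('h2 \<Rightarrow> 'h2)"
  assumes "rota_baxter (-1) \<B> P1'" and "rota_baxter (-1) \<B> P2'"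
    and "cstar_subalgebra A1 \<B>" and "cstar_subalgebra A2 \<B>"
    and "rota_baxter (-1) A1 P1" and "rota_baxter (-1) A2 P2"
  shows "((\<exists>\<pi>1. rota_baxter_star_rep (-1) A1 P1 P1' \<pi>1 (id :: 'h1 \<Rightarrow> 'h1)) \<and>
          (\<exists>\<pi>2. rota_baxter_star_rep (-1) A2 P2 P2' \<pi>2 (id :: 'h2 \<Rightarrow> 'h2)))
     \<longleftrightarrow> (\<exists>\<pi>. rota_baxter_star_rep (-1) (A1 \<oplus>\<^sub>* A2) (map_prod P1 P2)
                (block_rota_baxter P1' P2') \<pi> proj1 \<and>
              (\<forall>a1\<in>carr A1. \<pi> (a1, azero A2) \<in> corner1) \<and>
              (\<forall>a2\<in>carr A2. \<pi> (azero A1, a2) \<in> corner2))"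
proof -
  let ?A = "A1 \<oplus>\<^sub>* A2" and ?P = "map_prod P1 P2" and ?P' = "block_rota_baxter P1' P2'"
  have P: "rota_baxter (-1) ?A ?P"
    using assms(5,6) by (rule rota_baxter_direct_sum)
  have P': "rota_baxter (-1) \<B> ?P'"
    using assms(1,2) by (rule rota_baxter_block_rota_baxter)
  show ?thesis
  proof (intro iffI conjI; (elim conjE exE)?)
    fix \<pi>1 \<pi>2
    assume "rota_baxter_star_rep (-1) A1 P1 P1' \<pi>1 (id :: 'h1 \<Rightarrow> 'h1)"
      and "rota_baxter_star_rep (-1) A2 P2 P2' \<pi>2 (id :: 'h2 \<Rightarrow> 'h2)"
    then have h: "rota_baxter_hom A1 P1 \<B> P1' \<pi>1" "rota_baxter_hom A2 P2 \<B> P2' \<pi>2"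
      by (simp_all add: rota_baxter_star_rep_def)
    then have lin: "linear_map A1 \<B> \<pi>1" "linear_map A2 \<B> \<pi>2"
      by (simp_all add: rota_baxter_hom_def star_hom_def)
    have zero: "\<pi>1 (azero A1) = azero \<B>" "\<pi>2 (azero A2) = azero \<B>"
      using linear_map_zero[OF cstar_algebra_subalgebra cstar_algebra_bounded_operators] lin assms(3,4)
      by blast+
    let ?\<pi> = "block_diagonal \<circ> map_prod \<pi>1 \<pi>2"
    have "rota_baxter_star_rep (-1) ?A ?P ?P' ?\<pi> proj1"
    proof (rule rota_baxter_star_repI_idempotent[OF P P'])
      show "rota_baxter_hom ?A ?P \<B> ?P' ?\<pi>"
        by (rule rota_baxter_hom_compose[OF rota_baxter_hom_map_prod[OF h]
              rota_baxter_hom_block_diagonal])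
      show "?\<pi> a (proj1 x) = proj1 (?\<pi> a x)" if "a \<in> carr ?A" for a x
        using that lin by (cases a) (auto simp: direct_sum_def linear_map_def image_subset_iff
            bounded_operators_simps intro!: block_diagonal_proj1)
    qed (auto simp: proj1_def clinear_def scaleC_Pair)
    moreover have "\<forall>a1\<in>carr A1. ?\<pi> (a1, azero A2) \<in> corner1" "\<forall>a2\<in>carr A2. ?\<pi> (azero A1, a2) \<in> corner2"
      using lin by (auto simp: corner1_eq_image corner2_eq_image zero linear_map_def)
    ultimately show "\<exists>\<pi>. rota_baxter_star_rep (-1) ?A ?P ?P' \<pi> proj1 \<and>
        (\<forall>a1\<in>carr A1. \<pi> (a1, azero A2) \<in> corner1) \<and> (\<forall>a2\<in>carr A2. \<pi> (azero A1, a2) \<in> corner2)"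
      by blast
  next
    fix \<pi>
    assume "rota_baxter_star_rep (-1) ?A ?P ?P' \<pi> proj1"
      and c1: "\<forall>a1\<in>carr A1. \<pi> (a1, azero A2) \<in> corner1"
      and c2: "\<forall>a2\<in>carr A2. \<pi> (azero A1, a2) \<in> corner2"
    then have hom: "rota_baxter_hom ?A ?P \<B> ?P' \<pi>"
      by (simp add: rota_baxter_star_rep_def)
    have \<pi>: "rota_baxter_hom A1 P1 \<B> ?P' (\<lambda>a. \<pi> (a, azero A2))"
      "rota_baxter_hom A2 P2 \<B> ?P' (\<lambda>a. \<pi> (azero A1, a))"
      using rota_baxter_hom_inclusions[OF assms(5,6), THEN rota_baxter_hom_compose, OF hom]
      by (simp_all add: o_def)
    have "\<exists>\<pi>1. rota_baxter_hom A1 P1 \<B> P1' \<pi>1"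
      by (rule rota_baxter_hom_lift[OF \<pi>(1) rota_baxter_hom_corner_embeddings(1)[OF assms(1,2)]
            inj_on_corner_embeddings(1) _ assms(5,1)])
        (use c1 in \<open>auto simp: corner1_eq_image\<close>)
    then show "\<exists>\<pi>1. rota_baxter_star_rep (-1) A1 P1 P1' \<pi>1 (id :: 'h1 \<Rightarrow> 'h1)"
      using rota_baxter_star_repI_idempotent[OF assms(5,1), where f = id] by (auto simp: clinear_def)
    have "\<exists>\<pi>2. rota_baxter_hom A2 P2 \<B> P2' \<pi>2"
      by (rule rota_baxter_hom_lift[OF \<pi>(2) rota_baxter_hom_corner_embeddings(2)[OF assms(1,2)]
            inj_on_corner_embeddings(2) _ assms(6,2)])
        (use c2 in \<open>auto simp: corner2_eq_image\<close>)
    then show "\<exists>\<pi>2. rota_baxter_star_rep (-1) A2 P2 P2' \<pi>2 (id :: 'h2 \<Rightarrow> 'h2)"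
      using rota_baxter_star_repI_idempotent[OF assms(6,2), where f = id] by (auto simp: clinear_def)
  qed
qed

end
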